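(* For every $n \in \mathbb{N}$, it holds that $$S\left(2\mathbb{N},4n\right)\equiv 0 \pmod{4}.$$
   Context: $\mathbb{N}=\{1,2,3,\dots\}$ and $2\mathbb{N}=\{2,4,6,\dots\}$ is the set of even natural numbers. A partition $\lambda=(\lambda_1,\dots,\lambda_s)$ of $n\in\mathbb{N}$ is a non-increasing sequence of natural numbers with $\sum_{j=1}^s\lambda_j=n$; the $\lambda_j$ are its parts. For a subset $D\subset\mathbb{N}$, $S(D,n)\in\mathbb{Z}$ denotes the sum of all odd parts minus the sum of all even parts, taken over all partitions of $n$ in which parts from $D$ do not repeat (each element of $D$ occurs at most once as a part, while parts not in $D$ may repeat arbitrarily); parts are counted with multiplicity. Thus $S(2\mathbb{N},n)$ concerns partitions of $n$ whose even parts are distinct and whose odd parts are unrestricted. *)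

theory Defs
  imports "HOL-Number_Theory.Cong"
begin

definition is_partition :: "nat list \<Rightarrow> nat \<Rightarrow> bool" where
  "is_partition l n \<longleftrightarrow> sorted_wrt (\<ge>) l \<and> (\<forall>p\<in>set l. 1 \<le> p) \<and> sum_list l = n"

definition partitions_distinct :: "nat set \<Rightarrow> nat \<Rightarrow> nat list set" where
  "partitions_distinct D n = {l. is_partition l n \<and> (\<forall>d\<in>D. count_list l d \<le> 1)}"

definition S :: "nat set \<Rightarrow> nat \<Rightarrow> int" where
  "S D n = (\<Sum>l\<in>partitions_distinct D n.
     int (sum_list (filter odd l)) - int (sum_list (filter even l)))"

definition even_naturals :: "nat set" where
  "even_naturals = {k. 1 \<le> k \<and> even k}"

(* Guards against the convention that a sum over an infinite set is 0. *)
lemma finite_partitions_distinct: "finite (partitions_distinct D n)"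
proof (rule finite_subset)
  have len: "length l \<le> sum_list l" if "\<forall>p\<in>set l. 1 \<le> p" for l :: "nat list"
    using that by (induction l) auto
  show "partitions_distinct D n \<subseteq> {l. set l \<subseteq> {..n} \<and> length l \<le> n}"
    using len member_le_sum_list
    by (fastforce simp: partitions_distinct_def is_partition_def)
  show "finite {l. set l \<subseteq> {..n} \<and> length l \<le> n}"
    by (rule finite_lists_length_le) simp
qed

end

theory Submission
  imports Defs
begin

text \<open>The congruence holds partition by partition. The odd parts and the even parts
  of a partition of \<open>4 * n\<close> together sum to \<open>4 * n\<close>, so their difference is
  \<open>4 * n - 2 * e\<close>, where \<open>e\<close> is the sum of the even parts. As \<open>e\<close> is itself even,
  each summand of \<^const>\<open>S\<close> is a multiple of 4.\<close>

lemma sum_list_filter_odd_minus_even: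
  fixes l :: "nat list"
  shows "int (sum_list (filter odd l)) - int (sum_list (filter even l))
    = int (sum_list l) - 2 * int (sum_list (filter even l))"
  by (induction l) auto

lemma even_sum_list_filter_even: "even (sum_list (filter even (l :: nat list)))"
  by (induction l) auto

lemma four_dvd_odd_minus_even:
  fixes l :: "nat list"
  assumes "4 dvd sum_list l"
  shows "4 dvd int (sum_list (filter odd l)) - int (sum_list (filter even l))"
proof -
  obtain m where "sum_list l = 4 * m"
    using assms by (elim dvdE)
  moreover obtain k where "sum_list (filter even l) = 2 * k"
    using even_sum_list_filter_even[of l] by (elim dvdE)
  ultimately show ?thesis
    unfolding sum_list_filter_odd_minus_even by simp
qed

theorem theorem1p6:
  fixes n :: nat
  assumes "1 \<le> n"
  shows "[S even_naturals (4 * n) = 0] (mod 4)"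
  unfolding S_def cong_0_iff
  by (intro dvd_sum four_dvd_odd_minus_even)
    (simp add: partitions_distinct_def is_partition_def)

end
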